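(* If $n$ is a positive integer with $\omega(M_n)=2$, then $n=4$, or $n=6$, or $n=p_1$, or $n=p_1^2$ for some odd prime $p_1$. Furthermore, for such $n$: (i) if $n=p_1^2$ with $p_1$ an odd prime, then $M_n=M_{p_1}q^t$ for some prime $q$ and some positive integer $t$; (ii) if $n=p_1$ with $p_1$ an odd prime, then $M_n=p^sq^t$ where $p,q$ are distinct odd primes and $s,t$ are positive integers with $\gcd(s,t)=1$; moreover $p=2l_1p_1+1$ and $q=2l_2p_1+1$, where $l_1,l_2$ are distinct positive integers with $l_i\equiv 0$ or $l_i\equiv -p_1 \pmod 4$ for $i=1,2$.
   Context: For an integer $n\ge 0$, $M_n=2^n-1$ denotes the $n$-th Mersenne number. For a positive integer $m$, $\omega(m)$ denotes the number of distinct prime divisors of $m$. *)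

theory Defs
  imports "HOL-Number_Theory.Number_Theory"
begin

definition mersenne :: "nat \<Rightarrow> nat" where
  "mersenne n = 2 ^ n - 1"

definition prime_omega :: "nat \<Rightarrow> nat" where
  "prime_omega m = card (prime_factors m)"

end

theory Submission
  imports Defs
begin

text \<open>
  For even \<open>n = 2m\<close> the coprime factorisation \<open>M\<^sub>n = M\<^sub>m (2\<^sup>m + 1)\<close> makes both factors prime powers, and one
  of them is a power of 3. For odd \<open>n\<close>, since \<open>M\<^sub>d\<close> divides \<open>M\<^sub>n\<close> for every divisor \<open>d\<close> of \<open>n\<close>, it
  suffices that \<open>\<omega>(M\<^sub>d) \<ge> 3\<close> when \<open>d\<close> is the cube of a prime or a product of two distinct odd primes.
  For the cube, the chain \<open>M\<^sub>d\<close>, \<open>d = p, p\<^sup>2, p\<^sup>3\<close>, gains a coprime factor at each step, because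
  \<open>p\<close> never divides \<open>M\<^sub>d\<close>; the same coprimality gives the shape of \<open>M\<^sub>d\<close> for \<open>d = p\<^sup>2\<close>.
  For a prime exponent \<open>p\<close>, each prime factor \<open>w\<close> of \<open>M\<^sub>p\<close> has \<open>ord\<^sub>w(2) = p\<close>; this order is odd, so 2 is a
  square modulo \<open>w\<close> and \<open>w \<equiv> \<plusminus>1 (mod 8)\<close>. The exponents are coprime because \<open>M\<^sub>p\<close> is not a perfect power.
\<close>

section \<open>Mersenne numbers and the quotients \<open>M_ab / M_a\<close>\<close>

lemma mersenne_Suc: "Suc (mersenne n) = 2 ^ n"
  by (simp add: mersenne_def)

lemma mersenne_gt_1: "n \<ge> 2 \<Longrightarrow> mersenne n > 1"
  using power_increasing[of 2 n "2::nat"] by (simp add: mersenne_def)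

lemma mersenne_pos: "n > 0 \<Longrightarrow> mersenne n > 0"
  using one_less_power[of "2::nat" n] by (simp add: mersenne_def)

lemma odd_mersenne: "n > 0 \<Longrightarrow> odd (mersenne n)"
  by (simp add: mersenne_def)

lemma geometric_sum_nat: "y * (\<Sum>i<b. Suc y ^ i) + 1 = Suc y ^ b" for y :: nat
  by (induction b) (auto simp: algebra_simps)

lemma mersenne_mult: "mersenne (a * b) = mersenne a * (\<Sum>i<b. (2 ^ a) ^ i)"
  using geometric_sum_nat[of "mersenne a" b]
  by (simp add: mersenne_Suc power_mult mersenne_def[of "a * b"])

lemma mersenne_dvd: "a dvd b \<Longrightarrow> mersenne a dvd mersenne b"
  by (auto simp: mersenne_mult)

lemma dvd_mersenne_iff: "w dvd mersenne n \<longleftrightarrow> [2 ^ n = 1] (mod w)"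
  by (simp add: mersenne_def cong_altdef_nat)

lemma cong_geometric_sum: "[(\<Sum>i<b. (2 ^ a) ^ i) = b] (mod mersenne a)"
proof -
  have "[(2 ^ a) ^ i = 1] (mod mersenne a)" for i
    using cong_pow[of "2 ^ a" 1 "mersenne a" i] dvd_mersenne_iff[of "mersenne a" a] by simp
  then have "[(\<Sum>i<b. (2 ^ a) ^ i) = (\<Sum>i<b. 1)] (mod mersenne a)"
    by (intro cong_sum)
  then show ?thesis by simp
qed

text \<open>The sum is the quotient \<open>M_ab / M_a\<close>. Since \<open>2 ^ a\<close> is 1
  modulo \<open>M_a\<close>, each of its \<open>b\<close> terms is 1 there, which controls what the
  quotient can share with \<open>M_a\<close>.\<close>

lemma dvd_geometric_sum_imp_dvd:
  assumes "w dvd mersenne a" "w dvd (\<Sum>i<b. (2 ^ a) ^ i)"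
  shows "w dvd b"
  using cong_dvd_iff[OF cong_dvd_modulus_nat[OF cong_geometric_sum assms(1)]] assms(2) by blast

lemma coprimeI_prime_nat:
  fixes a b :: nat
  assumes "\<And>w. prime w \<Longrightarrow> w dvd a \<Longrightarrow> w dvd b \<Longrightarrow> False"
  shows "coprime a b"
proof -
  have "gcd a b = 1"
  proof (rule ccontr)
    assume "gcd a b \<noteq> 1"
    then obtain w where "prime w" "w dvd gcd a b"
      using prime_factor_nat by blast
    then show False
      using assms[of w] by simp
  qed
  then show ?thesis by (simp only: coprime_iff_gcd_eq_1)
qed

section \<open>Prime factors at prime and prime-power exponents\<close>

text \<open>The order of 2 modulo \<open>w\<close> divides the prime \<open>p\<close> and is not 1,
  so it is \<open>p\<close>; by Euler's theorem it divides \<open>w - 1\<close>.\<close>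

lemma prime_factor_mersenne_cong:
  assumes "prime w" "prime p" "w dvd mersenne p"
  shows "p dvd w - 1" "p < w" "odd w" "ord w 2 = p"
proof -
  have "odd (mersenne p)" using assms by (simp add: odd_mersenne prime_gt_0_nat)
  then show "odd w" using assms(3) by (meson dvd_trans)
  have "ord w 2 dvd p"
    using assms(3) by (simp add: dvd_mersenne_iff ord_divides')
  moreover have "ord w 2 \<noteq> 1"
  proof
    assume "ord w 2 = 1"
    then have "[2 = 1] (mod w)"
      using ord_divides[of 2 1 w] by simp
    then show False
      using assms(1) by (simp add: cong_altdef_nat)
  qed
  ultimately show ord: "ord w 2 = p"
    using assms(2) by (auto simp: prime_nat_iff)
  have "coprime w 2"
    using \<open>odd w\<close> by simp
  then show "p dvd w - 1"
    using order_divides_totient[of w 2] ord assms(1) by (simp add: totient_prime)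
  then show "p < w"
    using prime_gt_1_nat[OF assms(1)] by (auto dest: dvd_imp_le)
qed

text \<open>Iterating Fermat's \<open>2 ^ p = 2\<close> gives \<open>2 ^ (p ^ k) = 2\<close> modulo
  \<open>p\<close>, so divisibility would force 2 to be congruent to 1.\<close>

lemma prime_not_dvd_mersenne_power:
  assumes "prime p"
  shows "\<not> p dvd mersenne (p ^ k)"
proof
  assume dvd: "p dvd mersenne (p ^ k)"
  have "odd p" using dvd odd_mersenne[of "p ^ k"] assms
    by (meson dvd_trans prime_gt_0_nat zero_less_power)
  have "[2 ^ (p ^ k) = 2] (mod p)"
  proof (induction k)
    case (Suc k)
    have "\<not> p dvd 2 ^ (p ^ k)"
      using \<open>odd p\<close> assms prime_dvd_power_nat[of p 2 "p ^ k"]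
      by (metis dvd_refl primes_dvd_imp_eq two_is_prime_nat)
    then have "[(2 ^ (p ^ k)) ^ (p - 1) = 1] (mod p)"
      using fermat_theorem[OF assms, of "2 ^ (p ^ k)"] by simp
    then have "[(2 ^ (p ^ k)) ^ (p - 1) * 2 ^ (p ^ k) = 1 * 2 ^ (p ^ k)] (mod p)"
      by (rule cong_scalar_right)
    moreover have "(2 ^ (p ^ k)) ^ (p - 1) * 2 ^ (p ^ k) = ((2::nat) ^ (p ^ Suc k))"
      using prime_gt_0_nat[OF assms]
      by (simp add: power_minus_mult[of p, unfolded One_nat_def] mult.commute[of p] power_mult)
    ultimately show ?case
      using Suc by (metis cong_trans mult_1)
  qed auto
  then have "[2 = 1] (mod p)"
    using dvd by (metis dvd_mersenne_iff cong_sym cong_trans)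
  then show False
    using assms by (simp add: cong_altdef_nat)
qed

text \<open>A common prime would divide the number of terms \<open>p\<close>, hence equal
  \<open>p\<close>, which never divides \<open>M_(p^k)\<close>.\<close>

lemma coprime_mersenne_cofactor:
  assumes "prime p" "k > 0"
  shows "coprime (mersenne (p ^ k)) (\<Sum>i<p. (2 ^ p ^ k) ^ i)"
proof (rule coprimeI_prime_nat)
  fix w
  assume "prime w" "w dvd mersenne (p ^ k)" "w dvd (\<Sum>i<p. (2 ^ p ^ k) ^ i)"
  moreover from this have "w dvd p"
    using dvd_geometric_sum_imp_dvd by blast
  ultimately show False
    using assms prime_not_dvd_mersenne_power primes_dvd_imp_eq by blast
qed

lemma cofactor_gt_1:
  assumes "b \<ge> 2"
  shows "(\<Sum>i<b. (2 ^ a) ^ i) > (1::nat)"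
proof -
  have "(\<Sum>i<2. (2 ^ a) ^ i) \<le> (\<Sum>i<b. (2 ^ a) ^ i :: nat)"
    using assms by (intro sum_mono2) auto
  then show ?thesis
    by (simp add: numeral_2_eq_2 less_le_trans[rotated])
qed

section \<open>A new prime factor at a product of two primes\<close>

lemma binomial_cong: "[(1 + y) ^ i = 1 + i * y] (mod y ^ 2)" for y :: nat
proof (induction i)
  case (Suc i)
  have "[(1 + y) * (1 + y) ^ i = (1 + y) * (1 + i * y)] (mod y ^ 2)"
    using Suc by (rule cong_scalar_left)
  also have "(1 + y) * (1 + i * y) = (1 + Suc i * y) + i * y ^ 2"
    by (simp add: algebra_simps power2_eq_square)
  also have "[\<dots> = 1 + Suc i * y] (mod y ^ 2)"
    by (simp add: cong_def)
  finally show ?case by simp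
qed auto

text \<open>With \<open>y = M_a\<close>, the first-order binomial expansion of
  \<open>(1 + y) ^ i\<close> turns the sum into \<open>q + y * q * (q - 1) / 2\<close> modulo
  \<open>q ^ 2\<close>. As \<open>q\<close> is odd and divides \<open>y\<close>, the second term
  vanishes there and only \<open>q\<close> remains.\<close>

lemma square_not_dvd_geometric_sum:
  assumes "prime q" "odd q" "q dvd mersenne a"
  shows "\<not> q ^ 2 dvd (\<Sum>i<q. (2 ^ a) ^ i)"
proof
  let ?y = "mersenne a"
  assume dvd: "q ^ 2 dvd (\<Sum>i<q. (2 ^ a) ^ i)"
  have "[(\<Sum>i<q. (2 ^ a) ^ i) = (\<Sum>i<q. 1 + i * ?y)] (mod ?y ^ 2)"
    using binomial_cong[of ?y] by (intro cong_sum) (simp add: mersenne_Suc)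
  moreover have "q ^ 2 dvd ?y ^ 2"
    using assms(3) by (rule dvd_power_same)
  moreover have "(\<Sum>i<q. 1 + i * ?y) = q + (\<Sum>i<q. i) * ?y"
    by (simp only: sum.distrib sum_distrib_right) simp
  moreover have "q dvd (\<Sum>i<q. i)"
  proof -
    have "2 * (\<Sum>i<q. i) = q * (q - 1)"
      by (induction q) (auto simp: algebra_simps)
    then have "q dvd 2 * (\<Sum>i<q. i)" by simp
    then show ?thesis
      using assms(2) by (simp add: coprime_dvd_mult_right_iff)
  qed
  then have q2: "q ^ 2 dvd (\<Sum>i<q. i) * ?y"
    using assms(3) by (simp add: power2_eq_square mult_dvd_mono)
  ultimately have "[(\<Sum>i<q. (2 ^ a) ^ i) = q + (\<Sum>i<q. i) * ?y] (mod q ^ 2)"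
    by (metis (no_types) cong_dvd_modulus_nat)
  then have "q ^ 2 dvd q + (\<Sum>i<q. i) * ?y"
    using cong_dvd_iff dvd by blast
  then have "q ^ 2 dvd q"
    using q2 dvd_add_left_iff by blast
  then show False
    using prime_gt_1_nat[OF assms(1)] by (auto simp: power2_eq_square dest: dvd_imp_le)
qed

text \<open>Modulo a common prime, 2 would have order both \<open>p\<close> and
  \<open>q\<close>.\<close>

lemma coprime_mersenne_primes:
  assumes "prime p" "prime q" "p \<noteq> q"
  shows "coprime (mersenne p) (mersenne q)"
proof (rule coprimeI_prime_nat)
  fix w
  assume "prime w" "w dvd mersenne p" "w dvd mersenne q"
  then show False
    using assms prime_factor_mersenne_cong(4) by metis
qed

text \<open>
  If every prime factor of \<open>A = M\<^sub>p\<^sub>q / (M\<^sub>p M\<^sub>q)\<close> divided \<open>M\<^sub>p M\<^sub>q\<close>, it would have to be \<open>q\<close>, and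
  only to the first power; then \<open>A \<le> q\<close>, which is impossible by size.
\<close>
lemma primitive_prime_factor:
  assumes "prime p" "prime q" "p < q" "odd p"
  obtains w where "prime w" "w dvd mersenne (p * q)" "\<not> w dvd mersenne p" "\<not> w dvd mersenne q"
proof -
  note pq = prime_gt_0_nat[OF assms(1)] prime_gt_0_nat[OF assms(2)]
  have "p \<noteq> 2" using assms(4) by auto
  then have p3: "p \<ge> 3" using prime_ge_2_nat[OF assms(1)] by linarith
  then have "odd q"
    using assms(2,3) by (intro prime_odd_nat) auto
  have "mersenne p * mersenne q dvd mersenne (p * q)"
    using coprime_mersenne_primes[OF assms(1,2)] assms(3)
    by (intro divides_mult mersenne_dvd) auto
  then obtain A where A: "mersenne (p * q) = mersenne p * mersenne q * A" by auto
  \<comment> \<open>\<open>A\<close> divides both quotients \<open>M_pq / M_p\<close> and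
    \<open>M_pq / M_q\<close>, so a prime of \<open>A\<close> that divides \<open>M_p\<close>
    divides \<open>q\<close>, and one that divides \<open>M_q\<close> divides
    \<open>p\<close>.\<close>
  have Ap: "(\<Sum>i<q. (2 ^ p) ^ i) = mersenne q * A"
    using mersenne_mult[of p q] A mersenne_pos[OF pq(1)] by (simp add: mult.assoc)
  have Aq: "(\<Sum>i<p. (2 ^ q) ^ i) = mersenne p * A"
    using mersenne_mult[of q p] A mersenne_pos[OF pq(2)] by (simp add: ac_simps)
  have "\<exists>w. prime w \<and> w dvd A \<and> \<not> w dvd mersenne p \<and> \<not> w dvd mersenne q"
  proof (rule ccontr)
    assume "\<not> ?thesis"
    then have old: "w dvd mersenne p \<or> w dvd mersenne q" if "prime w" "w dvd A" for w
      using that by blast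
    have only: "w = q \<and> q dvd mersenne p" if w: "prime w" "w dvd A" for w
    proof -
      \<comment> \<open>Here \<open>w\<close> would be \<open>p\<close>, but prime factors of
        \<open>M_q\<close> exceed \<open>q\<close>, which exceeds \<open>p\<close>.\<close>
      have "\<not> w dvd mersenne q"
      proof
        assume wq: "w dvd mersenne q"
        then have "w dvd p"
          using w Aq by (intro dvd_geometric_sum_imp_dvd[of w q p]) auto
        then have "w = p"
          using w assms by (simp add: primes_dvd_imp_eq)
        then show False
          using prime_factor_mersenne_cong(2)[OF w(1) assms(2) wq] assms(3) by simp
      qed
      with old[OF w] have wp: "w dvd mersenne p" by blast
      then have "w dvd q"
        using w Ap by (intro dvd_geometric_sum_imp_dvd[of w p q]) auto
      then have "w = q"
        using w assms by (simp add: primes_dvd_imp_eq)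
      with wp show ?thesis by simp
    qed
    have "A \<le> q"
    proof (cases "A = 1")
      case False
      then obtain w where "prime w" "w dvd A"
        using prime_factor_nat by blast
      with only have q: "q dvd A" "q dvd mersenne p" by blast+
      then obtain B where B: "A = q * B" by auto
      have "B = 1"
      proof (rule ccontr)
        assume "B \<noteq> 1"
        then obtain v where v: "prime v" "v dvd B"
          using prime_factor_nat by blast
        with only[of v] B have "v = q" by simp
        then have "q ^ 2 dvd A"
          using v B by (simp add: power2_eq_square)
        then show False
          using square_not_dvd_geometric_sum[OF assms(2) \<open>odd q\<close> q(2)] Ap by simp
      qed
      with B show ?thesis by simp
    qed (use pq in simp)
    \<comment> \<open>The bound \<open>A \<le> q\<close> yields
      \<open>2 ^ (p * q) < 2 ^ (1 + p + 2 * q)\<close>, whereas \<open>p < q\<close> and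
      \<open>3 \<le> p\<close> give \<open>1 + p + 2 * q \<le> 3 * q \<le> p * q\<close>.\<close>
    have "2 ^ (p * q) \<le> (2::nat) * mersenne (p * q)"
      using mersenne_Suc[of "p * q"] mersenne_pos[of "p * q"] pq by simp
    also have "\<dots> \<le> 2 * (mersenne p * mersenne q * q)"
      using A \<open>A \<le> q\<close> by simp
    also have "\<dots> \<le> 2 * (2 ^ p * 2 ^ q * mersenne q)"
    proof -
      have "q \<le> mersenne q"
        using mersenne_Suc[of q] less_exp[of q] by linarith
      then show ?thesis
        by (intro mult_mono) (auto simp: mersenne_def)
    qed
    also have "\<dots> < 2 * (2 ^ p * 2 ^ q * 2 ^ q)"
      using mersenne_Suc[of q] by (simp flip: mersenne_Suc)
    also have "\<dots> = 2 ^ (1 + p + q + q)"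
      by (simp add: power_add)
    also have "\<dots> \<le> 2 ^ (p * q)"
    proof -
      have "3 * q \<le> p * q" using p3 by simp
      then have "1 + p + q + q \<le> p * q" using assms(3) by linarith
      then show ?thesis by (intro power_increasing) auto
    qed
    finally show False by simp
  qed
  then show ?thesis
    using that A by (metis dvd_mult)
qed

section \<open>Counting distinct prime factors\<close>

lemma prime_omega_mono: "m dvd n \<Longrightarrow> n > 0 \<Longrightarrow> prime_omega m \<le> prime_omega n"
  unfolding prime_omega_def by (intro card_mono dvd_prime_factors) auto

lemma prime_omega_mult:
  assumes "coprime a b" "a > 0" "b > 0"
  shows "prime_omega (a * b) = prime_omega a + prime_omega b"
proof -
  have "p \<notin> prime_factors b" if "p \<in> prime_factors a" for p
  proof
    assume "p \<in> prime_factors b"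
    then have "is_unit p"
      using that assms(1) by (meson coprime_common_divisor in_prime_factors_imp_dvd)
    then show False
      using that in_prime_factors_imp_prime not_prime_unit by blast
  qed
  then have "prime_factors a \<inter> prime_factors b = {}"
    by blast
  then show ?thesis
    using assms by (simp add: prime_omega_def prime_factors_product card_Un_disjoint)
qed

lemma prime_omega_pos:
  assumes "n > 1"
  shows "prime_omega n > 0"
proof -
  obtain p where "prime p" "p dvd n"
    using prime_factor_nat[of n] assms by auto
  then have "p \<in> prime_factors n"
    using assms by (simp add: prime_factors_dvd)
  then show ?thesis
    by (auto simp: prime_omega_def card_gt_0_iff)
qed

lemma prime_omega_eq_1E:
  assumes "prime_omega n = 1"
  obtains q t where "prime q" "t > 0" "n = q ^ t"
proof -
  obtain q where q: "prime_factors n = {q}"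
    using assms by (auto simp: prime_omega_def card_1_singleton_iff)
  then have "prime q" "multiplicity q n > 0"
    by (auto simp: prime_factors_multiplicity)
  moreover have "n > 0"
    using q by (cases "n = 0") auto
  then have "n = q ^ multiplicity q n"
    using prime_factorization_nat[of n] q by simp
  ultimately show ?thesis using that by blast
qed

lemma prime_omega_eq_2E:
  assumes "prime_omega n = 2"
  obtains p q s t where "prime p" "prime q" "p \<noteq> q" "s > 0" "t > 0" "n = p ^ s * q ^ t"
proof -
  obtain p q where pq: "prime_factors n = {p, q}" "p \<noteq> q"
    using assms by (auto simp: prime_omega_def card_2_iff)
  have "\<forall>r\<in>prime_factors n. prime r \<and> multiplicity r n > 0"
    by (auto simp: prime_factors_multiplicity)
  then have "prime p" "prime q" "multiplicity p n > 0" "multiplicity q n > 0"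
    using pq by auto
  moreover have "n > 0"
    using pq by (cases "n = 0") auto
  then have "n = p ^ multiplicity p n * q ^ multiplicity q n"
    using prime_factorization_nat[of n] pq by simp
  ultimately show ?thesis using that pq(2) by blast
qed

section \<open>Odd exponents\<close>

text \<open>The three primes are one from \<open>M_p\<close>, one from \<open>M_q\<close> and one
  dividing neither.\<close>

lemma prime_omega_mersenne_mult_ge_3:
  assumes "prime p" "prime q" "p < q" "odd p"
  shows "prime_omega (mersenne (p * q)) \<ge> 3"
proof -
  have pos: "mersenne (p * q) > 0"
    using assms by (simp add: mersenne_pos prime_gt_0_nat)
  obtain w where w: "prime w" "w dvd mersenne (p * q)" "\<not> w dvd mersenne p" "\<not> w dvd mersenne q"
    using primitive_prime_factor[OF assms] .
  obtain u where u: "prime u" "u dvd mersenne p"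
    using prime_factor_nat[of "mersenne p"] mersenne_gt_1[OF prime_ge_2_nat[OF assms(1)]] by auto
  obtain v where v: "prime v" "v dvd mersenne q"
    using prime_factor_nat[of "mersenne q"] mersenne_gt_1[OF prime_ge_2_nat[OF assms(2)]] by auto
  have "u \<noteq> v"
    using u v assms prime_factor_mersenne_cong(4) by (metis less_irrefl)
  moreover have "u \<noteq> w" "v \<noteq> w"
    using u v w by blast+
  ultimately have "card {u, v, w} = 3"
    by simp
  moreover have "{u, v, w} \<subseteq> prime_factors (mersenne (p * q))"
    using u v w pos dvd_trans[OF u(2) mersenne_dvd] dvd_trans[OF v(2) mersenne_dvd]
    by (simp add: prime_factors_dvd)
  ultimately show ?thesis
    using card_mono[OF finite_set_mset, of "{u, v, w}" "prime_factorization (mersenne (p * q))"]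
    by (simp only: prime_omega_def)
qed

lemma prime_omega_mersenne_power_Suc:
  assumes "prime p" "k > 0"
  shows "prime_omega (mersenne (p ^ Suc k)) =
    prime_omega (mersenne (p ^ k)) + prime_omega (\<Sum>i<p. (2 ^ p ^ k) ^ i)"
  using coprime_mersenne_cofactor[OF assms] cofactor_gt_1[OF prime_ge_2_nat[OF assms(1)], of "p ^ k"]
    mersenne_pos[of "p ^ k"] prime_gt_0_nat[OF assms(1)]
  by (simp add: prime_omega_mult mersenne_mult[of "p ^ k" p] mult.commute[of p])

lemma prime_omega_mersenne_cube_ge_3:
  assumes "prime p"
  shows "prime_omega (mersenne (p ^ 3)) \<ge> 3"
proof -
  have *: "prime_omega (\<Sum>i<p. (2 ^ p ^ k) ^ i) > 0" for k
    by (intro prime_omega_pos cofactor_gt_1 prime_ge_2_nat assms)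
  have "prime_omega (mersenne p) > 0"
    using assms by (intro prime_omega_pos mersenne_gt_1 prime_ge_2_nat)
  with *[of 1] *[of 2] show ?thesis
    using prime_omega_mersenne_power_Suc[OF assms, of 1] prime_omega_mersenne_power_Suc[OF assms, of 2]
    by (simp add: numeral_2_eq_2 numeral_3_eq_3)
qed

lemma odd_exponent_cases:
  assumes "odd n" "n > 1" "prime_omega (mersenne n) = 2"
  shows "\<exists>p. prime p \<and> odd p \<and> (n = p \<or> n = p ^ 2)"
proof -
  have small: "prime_omega (mersenne d) \<le> 2" if "d dvd n" for d
    using prime_omega_mono[OF mersenne_dvd[OF that]] mersenne_pos[of n] assms by simp
  obtain p where p: "prime p" "p dvd n"
    using assms(2) prime_factor_nat[of n] by auto
  have only: "q = p" if "prime q" "q dvd n" for q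
  proof (rule ccontr)
    assume "q \<noteq> p"
    then have "p * q dvd n"
      using p that by (intro divides_mult) (auto simp: primes_coprime)
    then have "prime_omega (mersenne (p * q)) \<le> 2" by (rule small)
    moreover have "odd p" "odd q"
      using p that assms(1) by (auto dest: dvd_trans)
    ultimately show False
      \<comment> \<open>The bound expects the smaller prime first, so both orders are
        supplied.\<close>
      using prime_omega_mersenne_mult_ge_3[of p q] prime_omega_mersenne_mult_ge_3[of q p] p that \<open>q \<noteq> p\<close>
      by (cases "p < q") (auto simp: mult.commute)
  qed
  obtain m where m: "n = p * m" using p by auto
  \<comment> \<open>Every prime factor of \<open>m\<close> is \<open>p\<close>; if \<open>m\<close>
    were neither value, two factors \<open>p\<close> could be split off, making \<open>p ^ 3\<close>
    divide \<open>n\<close>.\<close>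
  have "m = 1 \<or> m = p"
  proof (rule ccontr)
    assume neg: "\<not> ?thesis"
    then obtain q where "prime q" "q dvd m"
      using prime_factor_nat by blast
    then obtain m' where m': "m = p * m'"
      using only[of q] m by auto
    with neg obtain q' where "prime q'" "q' dvd m'"
      using prime_factor_nat[of m'] by auto
    then have "p dvd m'"
      using only[of q'] m m' by auto
    then have "p ^ 3 dvd n"
      using m m' by (simp add: power3_eq_cube mult.assoc)
    then show False
      using small prime_omega_mersenne_cube_ge_3[OF p(1)] by fastforce
  qed
  moreover have "odd p" using p assms(1) by (auto dest: dvd_trans)
  ultimately show ?thesis
    using p m by (auto simp: power2_eq_square)
qed

section \<open>Even exponents\<close>

lemma mersenne_double: "mersenne (2 * k) = mersenne k * (2 ^ k + 1)"
  using mersenne_mult[of k 2] by (simp add: mult.commute numeral_2_eq_2)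

text \<open>The two numbers are odd and differ by 2.\<close>

lemma coprime_mersenne_succ:
  assumes "k > 0"
  shows "coprime (mersenne k) (2 ^ k + 1)"
proof (rule coprimeI_prime_nat)
  fix w
  assume w: "prime w" "w dvd mersenne k" "w dvd 2 ^ k + 1"
  have "2 ^ k + 1 = mersenne k + 2"
    using mersenne_Suc[of k] by simp
  with w have "w dvd 2"
    using dvd_add_right_iff by metis
  then have "w = 2"
    using w(1) primes_dvd_imp_eq two_is_prime_nat by blast
  then show False
    using w(2) odd_mersenne[OF assms] by simp
qed

lemma prime_omega_mersenne_double:
  assumes "k > 0"
  shows "prime_omega (mersenne (2 * k)) = prime_omega (mersenne k) + prime_omega (2 ^ k + 1)"
  unfolding mersenne_double
  using assms by (intro prime_omega_mult coprime_mersenne_succ mersenne_pos) auto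

text \<open>Reduction modulo 4 makes \<open>k = 2 * j\<close> even. Then \<open>3 ^ j - 1\<close>
  and \<open>3 ^ j + 1\<close> are powers of 2 at distance 2, hence 2 and 4, with product
  \<open>2 ^ 3\<close>.\<close>

lemma pow_3_eq_pow_2_plus_1:
  assumes "(3::nat) ^ k = 2 ^ m + 1" "m \<ge> 2"
  shows "m = 3"
proof -
  have "even k"
  proof (rule ccontr)
    assume "odd k"
    then obtain j where "k = 2 * j + 1" by (auto elim: oddE)
    then have "(3::nat) ^ k = 9 ^ j * 3" by (simp add: power_mult)
    moreover have "[(9::nat) ^ j * 3 = 1 ^ j * 3] (mod 4)"
      by (intro cong_mult cong_pow) (auto simp: cong_def)
    then have "(9 ^ j * 3) mod 4 = (3::nat)" by (simp add: cong_def)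
    moreover have "(4::nat) dvd 2 ^ m"
      using le_imp_power_dvd[OF assms(2), of "2::nat"] by simp
    ultimately show False
      using assms(1) by presburger
  qed
  then obtain j where k: "k = 2 * j" by auto
  have "m \<noteq> 0" using assms by auto
  have eq: "(3 ^ j - 1) * (3 ^ j + 1) = (2::nat) ^ m"
    using assms(1) k by (simp add: algebra_simps power_mult power2_eq_square flip: power_mult_distrib power_add mult_2)
  then obtain a b where a: "3 ^ j - 1 = (2::nat) ^ a" and b: "3 ^ j + 1 = (2::nat) ^ b"
    using divides_primepow_nat[OF two_is_prime_nat] by (metis dvd_triv_left dvd_triv_right)
  have *: "(2::nat) ^ b = 2 ^ a + 2"
    using a b by (metis add.commute add_2_eq_Suc' diff_add_inverse2 diff_is_0_eq' le_add_diff_inverse2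
       nat_1_add_1 one_le_numeral one_le_power add.assoc)
  \<comment> \<open>Otherwise both powers of 2 are multiples of 4, yet they differ by 2.\<close>
  have "a < 2"
  proof (rule ccontr)
    assume "\<not> a < 2"
    then have "4 dvd (2::nat) ^ a"
      using le_imp_power_dvd[of 2 a "2::nat"] by simp
    moreover have "a < b"
      using * by (metis less_add_same_cancel1 one_less_numeral_iff power_strict_increasing_iff semiring_norm(76) zero_less_numeral)
    then have "4 dvd (2::nat) ^ b"
      using le_imp_power_dvd[of 2 b "2::nat"] \<open>\<not> a < 2\<close> by simp
    ultimately have "(4::nat) dvd 2"
      using * by (metis dvd_add_right_iff)
    then show False by simp
  qed
  moreover have "a \<noteq> 0"
  proof
    assume "a = 0"
    with a have "3 ^ j = (2::nat)" by simp
    then show False by (metis even_numeral odd_numeral even_power odd_one power_0)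
  qed
  ultimately have "a = 1" by simp
  with a have "3 ^ j = (3::nat)" by simp
  with eq have "(2::nat) ^ m = 2 ^ 3" by simp
  then show ?thesis by (metis power_inject_exp one_less_numeral_iff semiring_norm(76))
qed

lemma even_exponent_cases:
  assumes "even n" "n > 0" "prime_omega (mersenne n) = 2"
  shows "n = 4 \<or> n = 6"
proof -
  obtain m where m: "n = 2 * m" "m > 0" using assms by auto
  have sum: "prime_omega (mersenne m) + prime_omega (2 ^ m + 1) = 2"
    using prime_omega_mersenne_double[OF m(2)] assms m by simp
  have pos: "prime_omega (2 ^ k + 1) > 0" for k
    by (intro prime_omega_pos) auto
  show ?thesis
  proof (cases "m = 1")
    case True
    \<comment> \<open>For \<open>m = 1\<close> the sum is
      \<open>\<omega>(1) + \<omega>(3) = 1\<close>, contradicting 2.\<close>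
    then show ?thesis
      using sum by (simp add: mersenne_def prime_omega_def prime_factorization_prime)
  next
    case False
    then have "prime_omega (mersenne m) > 0"
      using m by (intro prime_omega_pos mersenne_gt_1) auto
    with sum pos[of m] have one: "prime_omega (mersenne m) = 1" "prime_omega (2 ^ m + 1) = 1"
      by linarith+
    show ?thesis
    proof (cases "even m")
      case True
      then obtain k where k: "m = 2 * k" "k > 0" using m by auto
      \<comment> \<open>For \<open>k > 1\<close> the factors \<open>M_k\<close> and
        \<open>2 ^ k + 1\<close> would each contribute a prime to \<open>M_m\<close>, which has only
        one.\<close>
      have "k = 1"
      proof (rule ccontr)
        assume "k \<noteq> 1"
        then have "prime_omega (mersenne k) > 0"
          using k by (intro prime_omega_pos mersenne_gt_1) auto
        then show False
          using pos[of k] one(1) prime_omega_mersenne_double[OF k(2)] k(1) by simp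
      qed
      then show ?thesis using k m by simp
    next
      case odd: False
      obtain q t :: nat where q: "prime q" "t > 0" "2 ^ m + 1 = q ^ t"
        using one(2) by (rule prime_omega_eq_1E)
      \<comment> \<open>For odd \<open>m\<close>, 2 is -1 modulo 3; the prime power
        \<open>2 ^ m + 1\<close> is therefore a power of 3.\<close>
      have "3 dvd (2::nat) ^ m + 1"
      proof -
        obtain j where "m = 2 * j + 1" using odd by (auto elim: oddE)
        then have "(2::nat) ^ m + 1 = 4 ^ j * 2 + 1" by (simp add: power_mult)
        moreover have "[(4::nat) ^ j * 2 + 1 = 1 ^ j * 2 + 1] (mod 3)"
          by (intro cong_add cong_mult cong_pow) (auto simp: cong_def)
        ultimately show ?thesis by (simp add: cong_def mod_eq_0_iff_dvd[symmetric])
      qed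
      moreover have "prime (3::nat)" by simp
      ultimately have "3 dvd q"
        using q by (metis prime_dvd_power_nat)
      then have "q = 3"
        using q primes_dvd_imp_eq \<open>prime 3\<close> by blast
      then have "m = 3"
        using pow_3_eq_pow_2_plus_1[of t m] q False m by simp
      then show ?thesis using m by simp
    qed
  qed
qed

section \<open>Prime and prime-square exponents: shape of the factorisation\<close>

text \<open>For even \<open>d\<close>, \<open>x ^ d + 1\<close> is an odd square plus 1, hence 2
  modulo 4. For odd \<open>d\<close>, \<open>x + 1\<close> divides \<open>x ^ d + 1 = 2 ^ n\<close>
  with an odd cofactor; this must be 1, so \<open>x ^ d = x\<close>.\<close>

lemma mersenne_not_perfect_power:
  assumes "mersenne n = x ^ d" "n \<ge> 2"
  shows "d = 1"
proof -
  have eq: "x ^ d + 1 = 2 ^ n"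
    using assms(1) mersenne_Suc[of n] by simp
  have "odd x" "d \<noteq> 0"
    using odd_mersenne[of n] mersenne_gt_1[of n] assms by (auto intro: Nat.gr0I)
  have "x \<noteq> 1"
    using mersenne_gt_1[of n] assms by auto
  have "4 dvd (2::nat) ^ n"
    using le_imp_power_dvd[OF assms(2), of "2::nat"] by simp
  have "odd d"
  proof
    assume "even d"
    then obtain e where "d = 2 * e" by auto
    then have "x ^ d = (x ^ e) ^ 2" by (simp add: power_mult[symmetric] mult.commute)
    moreover obtain z where "x ^ e = 2 * z + 1"
      using \<open>odd x\<close> by (meson oddE even_power)
    ultimately have "x ^ d + 1 = 4 * (z ^ 2 + z) + 2"
      by (simp add: power2_eq_square algebra_simps)
    with eq \<open>4 dvd (2::nat) ^ n\<close> have "(4::nat) dvd 4 * (z ^ 2 + z) + 2" by simp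
    then have "(4::nat) dvd 2"
      by (metis dvd_add_right_iff dvd_triv_left)
    then show False by simp
  qed
  \<comment> \<open>The cofactor of \<open>x + 1\<close> in \<open>x ^ d + 1\<close>, taken over the
    integers because its signs alternate. It is odd, as a sum of \<open>d\<close> odd terms with
    \<open>d\<close> odd.\<close>
  define S where "S = (\<Sum>i<d. (- int x) ^ i)"
  have "(- int x - 1) * S = (- int x) ^ d - 1"
    unfolding S_def by (simp add: power_diff_1_eq)
  then have S: "(int x + 1) * S = int x ^ d + 1"
    using \<open>odd d\<close> by (simp add: algebra_simps)
  have Spow: "(int x + 1) * S = 2 ^ n"
    using S arg_cong[OF eq, of int] by simp
  have "odd S"
  proof -
    have "[S = (\<Sum>i<d. 1)] (mod 2)"
      unfolding S_def using \<open>odd x\<close> by (intro cong_sum) (auto simp: cong_def mod_2_eq_odd)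
    then have "[S = int d] (mod 2)" by simp
    then show ?thesis
      using \<open>odd d\<close> cong_dvd_iff by fastforce
  qed
  then have "coprime S (2 ^ n)" by simp
  moreover have "S dvd 2 ^ n"
    using Spow by (metis dvd_triv_right)
  ultimately have "is_unit S"
    by (metis coprime_common_divisor dvd_refl)
  moreover have "S > 0"
    using Spow by (metis zero_less_mult_pos add_nonneg_pos of_nat_0_le_iff zero_less_one zero_less_numeral zero_less_power)
  ultimately have "S = 1" by auto
  with S have "int x ^ d = int x ^ 1" by simp
  then have "x ^ d = x ^ 1"
    by (metis of_nat_eq_iff of_nat_power)
  then show ?thesis
    using \<open>x \<noteq> 1\<close> \<open>odd x\<close> \<open>odd d\<close>
    by (metis (no_types) One_nat_def Suc_lessI even_zero gr0I power_inject_exp)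
qed

text \<open>The non-residue half of the second supplement to quadratic reciprocity.\<close>
lemma two_pow_half_cong_minus_1:
  assumes "prime p" "p mod 8 = 3 \<or> p mod 8 = 5"
  shows "[2 ^ ((p - 1) div 2) = - 1] (mod int p)"
proof -
  have "p > 2" using assms(2) by (cases "p \<le> 2") (auto simp: le_Suc_eq numeral_2_eq_2)
  interpret GAUSS p 2
    using assms(1) \<open>p > 2\<close> by unfold_locales (auto simp: cong_def)
  let ?h = "(int p - 1) div 2"
  let ?I = "{?h div 2 <.. ?h}"
  \<comment> \<open>In Gauss's lemma, \<open>A\<close> is \<open>1..h\<close>, \<open>C\<close>
    holds the residues of the doubles and \<open>E\<close> those above \<open>h\<close>. Doubles of
    elements of \<open>A\<close> stay below \<open>p\<close>, so reduction changes nothing.\<close>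
  have C: "C = (\<lambda>x. x * 2) ` A"
    unfolding C_def B_def image_image using p_eq2
    by (intro image_cong) (auto simp: A_def)
  have "E = (\<lambda>x. x * 2) ` ?I"
    unfolding E_def C A_def using \<open>p > 2\<close> by auto
  then have "card E = card ?I"
    by (simp add: card_image inj_on_def)
  also have "\<dots> = nat (?h - ?h div 2)" by simp
  finally have "int (card E) = ?h - ?h div 2"
    using \<open>p > 2\<close> by simp
  moreover have "odd (?h - ?h div 2)"
    using assms(2) by presburger
  ultimately have "odd (card E)"
    by (metis even_of_nat_iff)
  moreover have "nat ?h = (p - 1) div 2"
    using \<open>p > 2\<close> by (simp add: nat_div_distrib nat_diff_distrib)
  ultimately show ?thesis
    using pre_gauss_lemma by simp
qed

text \<open>Both 2 and \<open>p\<close> divide \<open>w - 1\<close>, which gives \<open>l\<close>.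
  Since \<open>2 ^ ((w - 1) / 2) = 2 ^ (p * l)\<close> is 1 modulo \<open>w\<close>, the residues 3
  and 5 modulo 8 are excluded; what remains constrains \<open>l\<close> modulo 4.\<close>

lemma mersenne_prime_factor_form:
  assumes "prime w" "prime p" "odd p" "w dvd mersenne p"
  obtains l where "l > 0" "w = 2 * l * p + 1" "[int l = 0] (mod 4) \<or> [int l = - int p] (mod 4)"
proof -
  note w = prime_factor_mersenne_cong[OF assms(1,2,4)]
  have "2 dvd w - 1" using w(3) by simp
  then have "2 * p dvd w - 1"
    using w(1) assms(3) by (intro divides_mult) auto
  then obtain l where l: "w - 1 = 2 * p * l" by auto
  have "w > 1" using assms(1) by (rule prime_gt_1_nat)
  have wl: "w = 2 * l * p + 1"
    using l \<open>w > 1\<close> by (simp add: ac_simps)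
  have "\<not> (w mod 8 = 3 \<or> w mod 8 = 5)"
  proof
    assume "w mod 8 = 3 \<or> w mod 8 = 5"
    then have "[2 ^ ((w - 1) div 2) = - 1] (mod int w)"
      by (rule two_pow_half_cong_minus_1[OF assms(1)])
    moreover have "(w - 1) div 2 = p * l" using l by simp
    moreover have "[2 ^ (p * l) = 1] (mod w)"
      using w(4) by (simp add: ord_divides')
    then have "[2 ^ (p * l) = 1] (mod int w)"
      using cong_int_iff[of "2 ^ (p * l)" 1 w] by simp
    ultimately have "[1 = - 1] (mod int w)"
      by (metis cong_sym cong_trans)
    then have "int w dvd 2" by (simp add: cong_iff_dvd_diff)
    then have "w dvd 2" by (metis of_nat_dvd_iff of_nat_numeral)
    then show False
      using w(3) assms(1) primes_dvd_imp_eq two_is_prime_nat by blast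
  qed
  with w(3) have mod8: "w mod 8 = 1 \<or> w mod 8 = 7" by presburger
  \<comment> \<open>Here \<open>2 * l * p\<close> is 0 or 6 modulo 8. An odd \<open>p\<close> is its
    own inverse modulo 4, so \<open>l * p = -1\<close> there means \<open>l = -p\<close>.\<close>
  have "(l * p) mod 4 = 0 \<or> (l * p) mod 4 = 3"
    using mod8 wl by (simp add: mult.assoc) presburger
  moreover have "p mod 4 = 1 \<or> p mod 4 = 3" using assms(3) by presburger
  moreover have "l mod 4 = 0 \<or> l mod 4 = 1 \<or> l mod 4 = 2 \<or> l mod 4 = 3" by presburger
  ultimately have "l mod 4 = 0 \<or> (l + p) mod 4 = 0"
    using mod_mult_eq[of l 4 p] mod_add_eq[of l 4 p] by auto
  then have "4 dvd int l \<or> 4 dvd int l + int p"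
    by presburger
  then have "[int l = 0] (mod 4) \<or> [int l = - int p] (mod 4)"
    by (simp add: cong_iff_dvd_diff)
  moreover have "l > 0" using l \<open>w > 1\<close> by (auto intro: Nat.gr0I)
  ultimately show ?thesis using that wl by blast
qed

text \<open>The coprime factors \<open>M_p\<close> and \<open>M_(p^2) / M_p\<close> both exceed 1,
  so each receives exactly one of the two primes.\<close>

lemma prime_square_exponent_form:
  assumes "prime p" "prime_omega (mersenne (p ^ 2)) = 2"
  obtains q t where "prime q" "t > 0" "mersenne (p ^ 2) = mersenne p * q ^ t"
proof -
  define Q :: nat where "Q = (\<Sum>i<p. (2 ^ p) ^ i)"
  have "prime_omega (mersenne p) + prime_omega Q = 2"
    using prime_omega_mersenne_power_Suc[OF assms(1), of 1] assms(2)
    by (simp add: Q_def power2_eq_square)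
  moreover have "prime_omega Q > 0"
    unfolding Q_def by (intro prime_omega_pos cofactor_gt_1 prime_ge_2_nat assms)
  moreover have "prime_omega (mersenne p) > 0"
    by (intro prime_omega_pos mersenne_gt_1 prime_ge_2_nat assms)
  ultimately have "prime_omega Q = 1" by linarith
  moreover have "mersenne (p ^ 2) = mersenne p * Q"
    by (simp add: Q_def mersenne_mult power2_eq_square)
  ultimately show ?thesis
    using that prime_omega_eq_1E by metis
qed

lemma prime_exponent_form:
  assumes "prime p1" "odd p1" "prime_omega (mersenne p1) = 2"
  shows "\<exists>p q s t l1 l2 :: nat.
        prime p \<and> odd p \<and> prime q \<and> odd q \<and> p \<noteq> q \<and>
        s > 0 \<and> t > 0 \<and> gcd s t = 1 \<and>
        mersenne p1 = p ^ s * q ^ t \<and>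
        l1 > 0 \<and> l2 > 0 \<and> l1 \<noteq> l2 \<and>
        p = 2 * l1 * p1 + 1 \<and> q = 2 * l2 * p1 + 1 \<and>
        (\<forall>l\<in>{l1, l2}. [int l = 0] (mod 4) \<or> [int l = - int p1] (mod 4))"
proof -
  obtain p q s t where pq: "prime p" "prime q" "p \<noteq> q" "s > 0" "t > 0" "mersenne p1 = p ^ s * q ^ t"
    using assms(3) by (rule prime_omega_eq_2E)
  have "p dvd p ^ s" "q dvd q ^ t"
    using pq by auto
  then have dvd: "p dvd mersenne p1" "q dvd mersenne p1"
    using pq(6) by auto
  obtain l1 where l1: "l1 > 0" "p = 2 * l1 * p1 + 1" "[int l1 = 0] (mod 4) \<or> [int l1 = - int p1] (mod 4)"
    using mersenne_prime_factor_form[OF pq(1) assms(1,2) dvd(1)] .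
  obtain l2 where l2: "l2 > 0" "q = 2 * l2 * p1 + 1" "[int l2 = 0] (mod 4) \<or> [int l2 = - int p1] (mod 4)"
    using mersenne_prime_factor_form[OF pq(2) assms(1,2) dvd(2)] .
  have "gcd s t = 1"
  proof -
    let ?d = "gcd s t"
    \<comment> \<open>A common divisor of the exponents exhibits \<open>M_p1\<close> as a perfect
      power.\<close>
    have "mersenne p1 = (p ^ (s div ?d) * q ^ (t div ?d)) ^ ?d"
      using pq(6) by (simp add: power_mult_distrib flip: power_mult)
    then show ?thesis
      using assms(1) by (intro mersenne_not_perfect_power prime_ge_2_nat)
  qed
  moreover have "odd p" "odd q"
    using l1 l2 by auto
  moreover have "l1 \<noteq> l2"
    using pq(3) l1 l2 by auto
  moreover have "\<forall>l\<in>{l1, l2}. [int l = 0] (mod 4) \<or> [int l = - int p1] (mod 4)"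
    using l1(3) l2(3) by blast
  ultimately show ?thesis
    using pq l1(1,2) l2(1,2)
    by (intro exI[of _ p] exI[of _ q] exI[of _ s] exI[of _ t] exI[of _ l1] exI[of _ l2] conjI)
qed

theorem theorem2:
  fixes n :: nat
  assumes "n > 0" and "prime_omega (mersenne n) = 2"
  shows "(n = 4 \<or> n = 6 \<or> (\<exists>p1::nat. prime p1 \<and> odd p1 \<and> (n = p1 \<or> n = p1 ^ 2))) \<and>
    (\<forall>p1::nat. prime p1 \<and> odd p1 \<and> n = p1 ^ 2 \<longrightarrow>
      (\<exists>q t :: nat. prime q \<and> t > 0 \<and> mersenne n = mersenne p1 * q ^ t)) \<and>
    (\<forall>p1::nat. prime p1 \<and> odd p1 \<and> n = p1 \<longrightarrow>
      (\<exists>p q s t l1 l2 :: nat.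
        prime p \<and> odd p \<and> prime q \<and> odd q \<and> p \<noteq> q \<and>
        s > 0 \<and> t > 0 \<and> gcd s t = 1 \<and>
        mersenne n = p ^ s * q ^ t \<and>
        l1 > 0 \<and> l2 > 0 \<and> l1 \<noteq> l2 \<and>
        p = 2 * l1 * p1 + 1 \<and> q = 2 * l2 * p1 + 1 \<and>
        (\<forall>l\<in>{l1, l2}. [int l = 0] (mod 4) \<or> [int l = - int p1] (mod 4))))"
proof (intro conjI allI impI)
  show "n = 4 \<or> n = 6 \<or> (\<exists>p1::nat. prime p1 \<and> odd p1 \<and> (n = p1 \<or> n = p1 ^ 2))"
  proof (cases "even n")
    case True
    then show ?thesis using even_exponent_cases assms by blast
  next
    case False
    \<comment> \<open>\<open>M_1 = 1\<close> has no prime factor.\<close>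
    moreover have "n \<noteq> 1"
      using assms(2) by (auto simp: mersenne_def prime_omega_def)
    ultimately show ?thesis using odd_exponent_cases[of n] assms by simp
  qed
next
  fix p1 :: nat
  assume "prime p1 \<and> odd p1 \<and> n = p1 ^ 2"
  then show "\<exists>q t :: nat. prime q \<and> t > 0 \<and> mersenne n = mersenne p1 * q ^ t"
    using prime_square_exponent_form[of p1] assms(2) by metis
next
  fix p1 :: nat
  assume "prime p1 \<and> odd p1 \<and> n = p1"
  then show "\<exists>p q s t l1 l2 :: nat.
        prime p \<and> odd p \<and> prime q \<and> odd q \<and> p \<noteq> q \<and>
        s > 0 \<and> t > 0 \<and> gcd s t = 1 \<and>
        mersenne n = p ^ s * q ^ t \<and>
        l1 > 0 \<and> l2 > 0 \<and> l1 \<noteq> l2 \<and>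
        p = 2 * l1 * p1 + 1 \<and> q = 2 * l2 * p1 + 1 \<and>
        (\<forall>l\<in>{l1, l2}. [int l = 0] (mod 4) \<or> [int l = - int p1] (mod 4))"
    using prime_exponent_form[of p1] assms(2) by blast
qed

end
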